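(* Let $d\ge 1$. For every instance $\mathcal{R}$ of the MinUsageTime Dynamic Vector Bin Packing problem in $d$ dimensions, the First Fit algorithm satisfies \[\mathsf{cost}(\mathrm{FF},\mathcal{R}) \le \big((\mu+2)d+1\big)\cdot \mathsf{OPT}(\mathcal{R}),\] where $\mu$ is the ratio of the maximum to the minimum item duration in $\mathcal{R}$. That is, the competitive ratio of First Fit is at most $(\mu+2)d+1$.
   Context: MinUsageTime Dynamic Vector Bin Packing (non-clairvoyant, online, no repacking): an instance is a finite list $\mathcal{R}$ of items; each item $r$ has arrival time $a(r)\ge 0$, departure time $e(r)>a(r)$, and size $\mathbf{s}(r)\in[0,1]^d$. Its active interval is $I(r)=[a(r),e(r))$ with duration $\ell(I(r))=e(r)-a(r)$; $\mu=\max_r \ell(I(r))/\min_r \ell(I(r))$. Bins have capacity $1$ in each of the $d$ coordinates. Items are revealed in order of arrival (ties in a given order); on arrival, an item must be irrevocably placed into a bin such that the total size of items currently active in that bin stays $\le 1$ in every coordinate; the departure time is unknown at arrival. A bin is open while it contains an active item; once all its items have departed it is closed and never used again. If bin $B_i$ receives item set $R_i$, the cost of algorithm $\mathcal{A}$ is $\mathsf{cost}(\mathcal{A},\mathcal{R})=\sum_i \mathrm{span}(R_i)$, where $\mathrm{span}(S)$ is the Lebesgue measure of $\bigcup_{r\in S} I(r)$. $\mathsf{OPT}(\mathcal{R})=\int \mathsf{OPT}(\mathcal{R},t)\,dt$, where $\mathsf{OPT}(\mathcal{R},t)$ is the minimum number of unit-capacity bins into which the items active at time $t$ can be packed (offline,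 repacking allowed). First Fit: an arriving item is placed into the earliest-opened currently open bin that can accommodate it; if none can, a new bin is opened. *)

theory Defs
  imports "HOL-Analysis.Analysis" "HOL-Library.Multiset"
begin

record ('d::finite) item =
  arrival :: real
  departure :: real
  item_size :: "real ^ 'd"

definition active_interval :: "'d::finite item \<Rightarrow> real set" where
  "active_interval r = {arrival r..<departure r}"

definition duration :: "'d::finite item \<Rightarrow> real" where
  "duration r = departure r - arrival r"

text \<open>
  An instance is a list rather than a set, so identical items may occur repeatedly;
  items with equal arrival times are revealed in list order.
\<close>

definition valid_instance :: "'d::finite item list \<Rightarrow> bool" where
  "valid_instance R \<longleftrightarrow>
     (\<forall>r \<in> set R. 0 \<le> arrival r \<and> arrival r < departure r \<and>
        (\<forall>i. 0 \<le> item_size r $ i \<and> item_size r $ i \<le> 1))"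

text \<open>For the empty instance the following value is unspecified.\<close>

definition duration_ratio :: "'d::finite item list \<Rightarrow> real" where
  "duration_ratio R = Max (duration ` set R) / Min (duration ` set R)"

definition active_items :: "'d::finite item list \<Rightarrow> real \<Rightarrow> 'd item list" where
  "active_items B t = filter (\<lambda>r. t \<in> active_interval r) B"

definition within_capacity :: "'d::finite item list \<Rightarrow> bool" where
  "within_capacity B \<longleftrightarrow> (\<forall>i. (\<Sum>r\<leftarrow>B. item_size r $ i) \<le> 1)"

text \<open>
  A bin is the list of all items it has received so far, departed items included.
  Since active intervals are half-open, an item departing at time \<open>t\<close> has already
  left when an item arriving at \<open>t\<close> is placed.
\<close>

definition bin_open :: "'d::finite item list \<Rightarrow> real \<Rightarrow> bool" where
  "bin_open B t \<longleftrightarrow> active_items B t \<noteq> []"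

definition can_accommodate :: "'d::finite item list \<Rightarrow> 'd item \<Rightarrow> bool" where
  "can_accommodate B r \<longleftrightarrow> within_capacity (r # active_items B (arrival r))"

text \<open>
  The bins are listed in the order in which they were opened. Closed bins stay in the
  list, since they contribute to the cost, but are skipped.
\<close>

fun first_fit_step :: "'d::finite item \<Rightarrow> 'd item list list \<Rightarrow> 'd item list list" where
  "first_fit_step r [] = [[r]]"
| "first_fit_step r (B # Bs) =
     (if bin_open B (arrival r) \<and> can_accommodate B r
      then (B @ [r]) # Bs
      else B # first_fit_step r Bs)"

text \<open>The sorting function is stable, so ties keep their given order.\<close>

definition first_fit :: "'d::finite item list \<Rightarrow> 'd item list list" where
  "first_fit R = fold first_fit_step (sort_key arrival R) []"

definition usage_span :: "'d::finite item set \<Rightarrow> real" where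
  "usage_span S = measure lborel (\<Union>r\<in>S. active_interval r)"

text \<open>An algorithm is represented by the map from instances to the resulting bins.\<close>

definition cost ::
    "('d::finite item list \<Rightarrow> 'd item list list) \<Rightarrow> 'd item list \<Rightarrow> real" where
  "cost A R = (\<Sum>B\<leftarrow>A R. usage_span (set B))"

definition packable :: "'d::finite item list \<Rightarrow> nat \<Rightarrow> bool" where
  "packable S k \<longleftrightarrow>
     (\<exists>Bs. length Bs = k \<and> mset (concat Bs) = mset S \<and> (\<forall>B \<in> set Bs. within_capacity B))"

definition OPT_at :: "'d::finite item list \<Rightarrow> real \<Rightarrow> nat" where
  "OPT_at R t = (LEAST k. packable (active_items R t) k)"

definition OPT :: "'d::finite item list \<Rightarrow> real" where
  "OPT R = (\<integral>t. real (OPT_at R t) \<partial>lborel)"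

end

theory Submission
  imports Defs
begin

text \<open>
  When an item \<open>r\<close> is put into a bin, every earlier bin is either closed for good or would
  overflow if \<open>r\<close> were added. Charge each moment at which a bin is in use to the first of its items
  active at that moment. The time charged to items that found all earlier bins closed is disjoint
  across bins, so it totals at most \<open>span(R) \<le> OPT\<close>. Any other \<open>r\<close> is blocked by the last earlier bin
  that is not closed: the \<open>1\<close>-norms of \<open>r\<close> and of the items \<open>q\<close> active there add up to more than 1,
  and the time charged to \<open>r\<close> is distributed over these items in proportion to their sizes. Since the
  blocking bin is the last one, pieces of time passed on to the same \<open>q\<close> are disjoint; they
  start while \<open>q\<close> is active and end at most the maximal duration after its departure. So \<open>q\<close> pays for
  at most \<open>(\<mu> + 2)\<close> times its duration, weighted by its \<open>1\<close>-norm, and the total of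
  duration times \<open>1\<close>-norm is at most \<open>d OPT\<close>.
\<close>

section \<open>The rejection invariant of First Fit\<close>

definition departed_by :: "'d::finite item list \<Rightarrow> real \<Rightarrow> bool" where
  "departed_by B t \<longleftrightarrow> (\<forall>q\<in>set B. departure q \<le> t)"

text \<open>Meant for bins in their final state. Items that reach \<open>B\<close> later than
  \<open>r\<close> count in \<open>departed_by\<close>, so the first case means closed for good, not
  just idle. Items added to \<open>B\<close> after \<open>r\<close> at the same arrival time count
  as active; sizes being nonnegative, they preserve the overflow.\<close>

definition rejects :: "'d::finite item list \<Rightarrow> 'd item list \<Rightarrow> bool" where
  "rejects B B' \<longleftrightarrow> (\<forall>r\<in>set B'. departed_by B (arrival r) \<or>
     \<not> within_capacity (r # active_items B (arrival r)))"

definition total_size :: "'d::finite item \<Rightarrow> real" where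
  "total_size r = (\<Sum>i\<in>UNIV. item_size r $ i)"

definition valid_item :: "'d::finite item \<Rightarrow> bool" where
  "valid_item r \<longleftrightarrow> 0 \<le> arrival r \<and> arrival r < departure r \<and>
     (\<forall>i. 0 \<le> item_size r $ i \<and> item_size r $ i \<le> 1)"

lemma valid_instance_iff: "valid_instance R \<longleftrightarrow> (\<forall>r\<in>set R. valid_item r)"
  by (simp add: valid_instance_def valid_item_def)

lemma total_size_nonneg: "valid_item r \<Longrightarrow> 0 \<le> total_size r"
  by (auto simp: total_size_def valid_item_def intro: sum_nonneg)

lemma item_size_le_total_size: "valid_item r \<Longrightarrow> item_size r $ i \<le> total_size r"
  unfolding total_size_def by (rule member_le_sum) (auto simp: valid_item_def)

lemma mset_concat_first_fit_step:
  "mset (concat (first_fit_step r Bs)) = add_mset r (mset (concat Bs))"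
  by (induction r Bs rule: first_fit_step.induct) auto

lemma mset_concat_first_fit: "mset (concat (first_fit R)) = mset R"
proof -
  have "mset (concat (fold first_fit_step xs Bs)) = mset xs + mset (concat Bs)"
    for xs :: "'a item list" and Bs
    by (induction xs arbitrary: Bs) (auto simp: mset_concat_first_fit_step simp del: mset_concat)
  from this[of "sort_key arrival R" "[]"] show ?thesis
    by (simp add: first_fit_def)
qed

text \<open>
  An open bin is not departed by any earlier time, so it stood in the overflow case for all earlier
  items, and overflow persists when the bin receives a further item.
\<close>

lemma rejects_append_left:
  assumes "rejects B B'" "bin_open B (arrival r)" "\<forall>q\<in>set B'. arrival q \<le> arrival r" "valid_item r"
  shows "rejects (B @ [r]) B'"
  unfolding rejects_def
proof (intro ballI disjI2)
  fix q assume q: "q \<in> set B'"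
  from assms(2) obtain p where "p \<in> set B" "arrival r < departure p"
    by (auto simp: bin_open_def active_items_def active_interval_def filter_empty_conv)
  moreover have "arrival q \<le> arrival r" using assms(3) q by auto
  ultimately have "\<not> departed_by B (arrival q)" by (force simp: departed_by_def)
  then have "\<not> within_capacity (q # active_items B (arrival q))"
    using assms(1) q by (auto simp: rejects_def)
  then obtain i where "1 < (\<Sum>x\<leftarrow>q # active_items B (arrival q). item_size x $ i)"
    by (auto simp: within_capacity_def not_le)
  also have "\<dots> \<le> (\<Sum>x\<leftarrow>q # active_items (B @ [r]) (arrival q). item_size x $ i)"
    using assms(4) by (auto simp: active_items_def valid_item_def)
  finally show "\<not> within_capacity (q # active_items (B @ [r]) (arrival q))"
    unfolding within_capacity_def not_all not_le by blast
qed

lemma in_set_first_fit_stepE: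
  assumes "B \<in> set (first_fit_step r Bs)"
  obtains "B \<in> set Bs" | "B = [r]" | B' where "B' \<in> set Bs" "B = B' @ [r]"
  using assms by (induction r Bs rule: first_fit_step.induct) (auto split: if_splits)

text \<open>First Fit passes over a bin only if it is closed or would overflow, so every bin before
  the receiving one rejects \<open>r\<close>. The receiving bin grows, and
  \<open>rejects_append_left\<close> preserves its relation to the bins after it.\<close>

lemma sorted_wrt_rejects_first_fit_step:
  assumes "sorted_wrt rejects Bs" "\<forall>B\<in>set Bs. \<forall>q\<in>set B. arrival q \<le> arrival r" "valid_item r"
  shows "sorted_wrt rejects (first_fit_step r Bs)"
  using assms
proof (induction r Bs rule: first_fit_step.induct)
  case (1 r)
  then show ?case by simp
next
  case (2 r B Bs)
  show ?case
  proof (cases "bin_open B (arrival r) \<and> can_accommodate B r")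
    case True
    then show ?thesis using 2(2-4) by (auto intro: rejects_append_left)
  next
    case False
    \<comment> \<open>The arrival order enters here: an item of \<open>B\<close> that is inactive at
      \<open>arrival r\<close> has already arrived, hence has departed.\<close>
    have "departed_by B (arrival r) \<or> \<not> within_capacity (r # active_items B (arrival r))"
      using False 2(3)
      by (force simp: bin_open_def can_accommodate_def departed_by_def active_items_def
          active_interval_def filter_empty_conv not_less)
    moreover have "\<forall>B'\<in>set Bs. rejects B B'" using 2(2) by simp
    ultimately have "rejects B B'" if "B' \<in> set (first_fit_step r Bs)" for B'
      using that by (elim in_set_first_fit_stepE) (simp_all add: rejects_def ball_Un)
    then show ?thesis using False 2 by auto
  qed
qed

lemma sorted_wrt_rejects_first_fit:
  assumes "valid_instance R"
  shows "sorted_wrt rejects (first_fit R)"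
proof -
  have "sorted_wrt rejects (fold first_fit_step xs Bs)"
    if "sorted_wrt rejects Bs" "\<forall>q\<in>set (concat Bs). \<forall>x\<in>set xs. arrival q \<le> arrival x"
       "sorted (map arrival xs)" "\<forall>x\<in>set xs. valid_item x" for xs :: "'a item list" and Bs
    using that
  proof (induction xs arbitrary: Bs)
    case (Cons x xs)
    have "set (concat (first_fit_step x Bs)) = insert x (set (concat Bs))"
      using arg_cong[OF mset_concat_first_fit_step[of x Bs], of set_mset]
      by (simp only: set_mset_mset set_mset_add_mset_insert)
    then show ?case
      unfolding fold.simps comp_def
      using Cons.prems by (intro Cons.IH sorted_wrt_rejects_first_fit_step) auto
  qed simp
  from this[of "[]" "sort_key arrival R"] assms show ?thesis
    by (simp add: first_fit_def valid_instance_iff)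
qed

section \<open>The charging argument\<close>

lemma active_interval_fmeasurable: "active_interval r \<in> fmeasurable lborel"
  unfolding active_interval_def
  by (cases "arrival r \<le> departure r") (auto intro!: fmeasurableI)

lemma measure_active_interval: "valid_item r \<Longrightarrow> measure lborel (active_interval r) = duration r"
  by (simp add: active_interval_def duration_def valid_item_def)

text \<open>Equal items may recur, so the charging argument works with positions (bin, index in the
  bin); this leads back to sums over lists.\<close>

lemma sum_indices_eq_sum_list_concat:
  fixes f :: "'a \<Rightarrow> 'b::comm_monoid_add"
  shows "(\<Sum>(i, k)\<in>(SIGMA i:{..<length xss}. {..<length (xss ! i)}). f (xss ! i ! k)) = (\<Sum>x\<leftarrow>concat xss. f x)"
proof -
  have "(\<Sum>(i, k)\<in>(SIGMA i:{..<length xss}. {..<length (xss ! i)}). f (xss ! i ! k))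
      = (\<Sum>i<length xss. \<Sum>k<length (xss ! i). f (xss ! i ! k))"
    by (subst sum.Sigma[symmetric]) auto
  also have "\<dots> = (\<Sum>i<length xss. \<Sum>x\<leftarrow>xss ! i. f x)"
    by (simp add: sum_list_sum_nth atLeast0LessThan)
  also have "\<dots> = (\<Sum>x\<leftarrow>concat xss. f x)"
    by (induction xss) (simp_all add: sum.lessThan_Suc_shift del: sum.lessThan_Suc)
  finally show ?thesis .
qed

text \<open>Some coordinate overflows, and by nonnegativity each coordinate is bounded by the
  1-norm. Passing to the 1-norm is what later costs the factor \<open>d\<close>.\<close>

lemma rejects_imp_total_size_gt_1:
  assumes "rejects B B'" "r \<in> set B'" "\<not> departed_by B (arrival r)"
      and "valid_item r" "\<forall>q\<in>set B. valid_item q"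
  shows "1 < total_size r + (\<Sum>q\<leftarrow>active_items B (arrival r). total_size q)"
proof -
  obtain i where "1 < item_size r $ i + (\<Sum>q\<leftarrow>active_items B (arrival r). item_size q $ i)"
    using assms(1-3) by (auto simp: rejects_def within_capacity_def not_le)
  also have "\<dots> \<le> total_size r + (\<Sum>q\<leftarrow>active_items B (arrival r). total_size q)"
    using assms(4,5) by (intro add_mono sum_list_mono item_size_le_total_size) (auto simp: active_items_def)
  finally show ?thesis .
qed

text \<open>The weight of \<open>q\<close> splits into \<open>duration q\<close>, for the time
  charged to \<open>q\<close> itself, and \<open>duration q + M\<close>, for the time passed on by
  the items that \<open>q\<close> helps to block.\<close>

lemma sum_usage_span_le:
  fixes Bs :: "'d::finite item list list"
  assumes rej: "sorted_wrt rejects Bs"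
      and valid: "\<forall>r\<in>set (concat Bs). valid_item r"
      and M: "\<forall>r\<in>set (concat Bs). duration r \<le> M"
  shows "(\<Sum>B\<leftarrow>Bs. usage_span (set B)) \<le> usage_span (set (concat Bs)) +
           (\<Sum>q\<leftarrow>concat Bs. (2 * duration q + M) * total_size q)"
proof -
  define J where "J = (SIGMA i:{..<length Bs}. {..<length (Bs ! i)})"
  define item where "item = (\<lambda>(i, k). Bs ! i ! k)"
  \<comment> \<open>\<open>X (i, k)\<close>: the times at which item \<open>k\<close> is the first active item of bin \<open>i\<close>\<close>
  define X where "X = (\<lambda>(i, k). disjointed (\<lambda>k. active_interval (Bs ! i ! k)) k)"
  define blockers where "blockers = (\<lambda>j. {h. h < fst j \<and> \<not> departed_by (Bs ! h) (arrival (item j))})"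
  define J0 where "J0 = {j\<in>J. blockers j = {}}"
  define J1 where "J1 = J - J0"
  \<comment> \<open>\<open>Max {}\<close> is unspecified; \<open>blocker j\<close> matters only for
    \<open>j \<in> J1\<close>, where \<open>blockers j\<close> is nonempty.\<close>
  define blocker where "blocker = (\<lambda>j. Max (blockers j))"
  define \<sigma> where "\<sigma> = (\<lambda>j. total_size (item j))"
  have fin: "finite J" "finite J0" "finite J1" by (auto simp: J_def J0_def J1_def)
  have J_eq: "J = J0 \<union> J1" "J0 \<inter> J1 = {}" "J0 \<subseteq> J" "J1 \<subseteq> J" by (auto simp: J0_def J1_def)
  have item_Bs: "item j \<in> set (Bs ! fst j)" "fst j < length Bs" "Bs ! fst j \<in> set Bs" if "j \<in> J" for j
    using that by (auto simp: J_def item_def)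
  then have item_in: "item j \<in> set (concat Bs)" if "j \<in> J" for j
    unfolding set_concat using that by (intro UN_I)
  have item_valid: "valid_item (item j)" and item_M: "duration (item j) \<le> M" if "j \<in> J" for j
    using item_in[OF that] valid M by blast+
  have \<sigma>_nonneg: "0 \<le> \<sigma> j" if "j \<in> J" for j
    using item_valid[OF that] by (simp add: \<sigma>_def total_size_nonneg)
  have X_sub: "X j \<subseteq> active_interval (item j)" for j
    unfolding X_def item_def by (auto simp: disjointed_def split: prod.splits)
  have X_meas: "X j \<in> fmeasurable lborel" for j
  proof (rule fmeasurableI2[OF active_interval_fmeasurable X_sub])
    show "X j \<in> sets lborel"
      unfolding X_def by (auto simp: disjointed_def active_interval_def split: prod.splits)
  qed
  have X_sets: "X j \<in> sets borel" for j
    using fmeasurableD[OF X_meas[of j]] by simp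
  have X_disj: "X j \<inter> X j' = {}" if "fst j = fst j'" "j \<noteq> j'" for j j'
    using that disjoint_family_disjointed[of "\<lambda>k. active_interval (Bs ! fst j ! k)"]
    unfolding X_def disjoint_family_on_def by (cases j; cases j') auto
  \<comment> \<open>Inside one bin the sets \<open>X j\<close> are disjoint by construction, so only
    pairs from different bins remain to be checked.\<close>
  have measure_X_UN: "measure lborel (\<Union>j\<in>K. X j) = (\<Sum>j\<in>K. measure lborel (X j))"
    if "finite K" "\<And>j j'. j \<in> K \<Longrightarrow> j' \<in> K \<Longrightarrow> fst j < fst j' \<Longrightarrow> X j \<inter> X j' = {}" for K
  proof (rule measure_finite_Union[OF that(1)])
    show "X ` K \<subseteq> sets lborel" by (simp add: X_sets image_subset_iff)
    show "disjoint_family_on X K"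
      unfolding disjoint_family_on_def
      using that(2) X_disj by (metis Int_commute linorder_neqE_nat)
    show "emeasure lborel (X j) \<noteq> \<infinity>" for j using fmeasurableD2[OF X_meas[of j]] by simp
  qed
  have X_le: "measure lborel (X j) \<le> duration (item j)" if "j \<in> J" for j
    using measure_mono_fmeasurable[OF X_sub _ active_interval_fmeasurable, of j]
    by (simp add: X_sets measure_active_interval item_valid that)
  \<comment> \<open>Intervals are half-open, so an item departing exactly when
    \<open>item j'\<close> arrives causes no overlap.\<close>
  have after: "X j \<inter> X j' = {}" if "j \<in> J" "departed_by (Bs ! fst j) (arrival (item j'))" for j j'
    using X_sub[of j] X_sub[of j'] item_Bs[OF that(1)] that(2)
    by (force simp: departed_by_def active_interval_def)

  have "(\<Sum>B\<leftarrow>Bs. usage_span (set B)) = (\<Sum>i<length Bs. usage_span (set (Bs ! i)))"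
    by (simp add: sum_list_sum_nth atLeast0LessThan)
  also have "\<dots> = (\<Sum>i<length Bs. \<Sum>k<length (Bs ! i). measure lborel (X (i, k)))"
  proof (intro sum.cong refl)
    fix i assume "i \<in> {..<length Bs}"
    have "(\<Union>r\<in>set (Bs ! i). active_interval r) = (\<Union>k<length (Bs ! i). active_interval (Bs ! i ! k))"
      by (auto simp: set_conv_nth)
    also have "\<dots> = (\<Union>k<length (Bs ! i). X (i, k))"
      using finite_UN_disjointed_eq[of "\<lambda>k. active_interval (Bs ! i ! k)" "length (Bs ! i)"]
      by (simp add: X_def atLeast0LessThan)
    also have "\<dots> = (\<Union>j\<in>Pair i ` {..<length (Bs ! i)}. X j)" by simp
    finally have "usage_span (set (Bs ! i)) = (\<Sum>j\<in>Pair i ` {..<length (Bs ! i)}. measure lborel (X j))"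
      unfolding usage_span_def by (simp only:, subst measure_X_UN) auto
    also have "\<dots> = (\<Sum>k<length (Bs ! i). measure lborel (X (i, k)))"
      by (subst sum.reindex) (auto simp: inj_on_def)
    finally show "usage_span (set (Bs ! i)) = (\<Sum>k<length (Bs ! i). measure lborel (X (i, k)))" .
  qed
  also have "\<dots> = (\<Sum>j\<in>J. measure lborel (X j))"
    unfolding J_def by (subst sum.Sigma) auto
  also have "\<dots> = (\<Sum>j\<in>J0. measure lborel (X j)) + (\<Sum>j\<in>J1. measure lborel (X j))"
    using fin J_eq by (simp add: sum.union_disjoint)
  also have "(\<Sum>j\<in>J0. measure lborel (X j)) \<le> usage_span (set (concat Bs))"
  proof -
    have "(\<Sum>j\<in>J0. measure lborel (X j)) = measure lborel (\<Union>j\<in>J0. X j)"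
    proof (rule measure_X_UN[symmetric])
      fix j j' assume "j \<in> J0" "j' \<in> J0" "fst j < fst j'"
      \<comment> \<open>Since \<open>blockers j'\<close> is empty, the earlier bin
        \<open>fst j\<close> is closed for good when \<open>item j'\<close> arrives.\<close>
      then show "X j \<inter> X j' = {}" by (intro after) (auto simp: J0_def blockers_def)
    qed (rule fin)
    also have "\<dots> \<le> usage_span (set (concat Bs))"
      unfolding usage_span_def
    proof (rule measure_mono_fmeasurable)
      show "(\<Union>j\<in>J0. X j) \<subseteq> (\<Union>r\<in>set (concat Bs). active_interval r)"
        using X_sub item_in J_eq by blast
      show "(\<Union>j\<in>J0. X j) \<in> sets lborel"
        using fin by (intro sets.finite_UN) (simp_all add: X_sets)
      show "(\<Union>r\<in>set (concat Bs). active_interval r) \<in> fmeasurable lborel"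
        using active_interval_fmeasurable by (intro fmeasurable.finite_UN) auto
    qed
    finally show ?thesis .
  qed
  also have "(\<Sum>j\<in>J1. measure lborel (X j)) \<le> (\<Sum>q\<leftarrow>concat Bs. (2 * duration q + M) * total_size q)"
  proof -
    \<comment> \<open>For \<open>j \<in> J1\<close>, \<open>j\<close> and the members of
      \<open>C j\<close> pay for \<open>X j\<close>, each with its 1-norm as weight; by
      \<open>gt1\<close> these weights exceed 1 in total.\<close>
    define C where "C = (\<lambda>j. {q\<in>J. fst q = blocker j \<and> arrival (item j) \<in> active_interval (item q)})"
    have blocker: "blocker j < fst j" "\<not> departed_by (Bs ! blocker j) (arrival (item j))"
      and blocker_max: "\<And>h. blocker j < h \<Longrightarrow> h < fst j \<Longrightarrow> departed_by (Bs ! h) (arrival (item j))"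
      if "j \<in> J1" for j
    proof -
      have "finite (blockers j)" "blockers j \<noteq> {}"
        using that by (auto simp: J1_def J0_def blockers_def)
      then have *: "blocker j \<in> blockers j" "\<And>h. h \<in> blockers j \<Longrightarrow> h \<le> blocker j"
        unfolding blocker_def by auto
      show "blocker j < fst j" "\<not> departed_by (Bs ! blocker j) (arrival (item j))"
        using *(1) by (auto simp: blockers_def)
      show "departed_by (Bs ! h) (arrival (item j))" if "blocker j < h" "h < fst j" for h
        using *(2)[of h] that by (auto simp: blockers_def)
    qed
    have gt1: "1 < \<sigma> j + (\<Sum>q\<in>C j. \<sigma> q)" if "j \<in> J1" for j
    proof -
      have j: "j \<in> J" using that J_eq by auto
      let ?h = "blocker j"
      have h: "?h < fst j" "?h < length Bs" using blocker(1)[OF that] item_Bs[OF j] by auto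
      have "1 < total_size (item j) + (\<Sum>q\<leftarrow>active_items (Bs ! ?h) (arrival (item j)). total_size q)"
      proof (rule rejects_imp_total_size_gt_1)
        show "rejects (Bs ! ?h) (Bs ! fst j)"
          using rej h item_Bs[OF j] by (auto intro: sorted_wrt_nth_less)
        show "\<forall>q\<in>set (Bs ! ?h). valid_item q" using valid h by auto
      qed (use blocker[OF that] item_Bs[OF j] item_valid[OF j] in auto)
      also have "(\<Sum>q\<leftarrow>active_items (Bs ! ?h) (arrival (item j)). total_size q) =
          (\<Sum>q\<leftarrow>Bs ! ?h. if arrival (item j) \<in> active_interval q then total_size q else 0)"
        unfolding active_items_def by (rule sum_list_map_filter')
      also have "\<dots> = (\<Sum>k<length (Bs ! ?h). if arrival (item j) \<in> active_interval (item (?h, k)) then \<sigma> (?h, k) else 0)"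
        by (auto simp: sum_list_sum_nth atLeast0LessThan item_def \<sigma>_def intro!: sum.cong)
      also have "\<dots> = (\<Sum>q\<in>Pair ?h ` {k\<in>{..<length (Bs ! ?h)}. arrival (item j) \<in> active_interval (item (?h, k))}. \<sigma> q)"
        unfolding sum.inter_filter[OF finite_lessThan, symmetric]
        by (subst sum.reindex) (auto simp: inj_on_def)
      also have "Pair ?h ` {k\<in>{..<length (Bs ! ?h)}. arrival (item j) \<in> active_interval (item (?h, k))} = C j"
        using h by (auto simp: C_def J_def)
      finally show ?thesis by (simp add: \<sigma>_def)
    qed
    have charged: "(\<Sum>j\<in>{j\<in>J1. q \<in> C j}. measure lborel (X j)) \<le> duration (item q) + M" if "q \<in> J" for q
    proof -
      let ?K = "{j\<in>J1. q \<in> C j}"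
      \<comment> \<open>An item passing time on to \<open>q\<close> arrives while \<open>q\<close>
        is active and lasts at most \<open>M\<close>.\<close>
      let ?I = "{arrival (item q)..departure (item q) + M}"
      have "(\<Sum>j\<in>?K. measure lborel (X j)) = measure lborel (\<Union>j\<in>?K. X j)"
      proof (rule measure_X_UN[symmetric])
        fix j j' assume *: "j \<in> ?K" "j' \<in> ?K" "fst j < fst j'"
        \<comment> \<open>Both blocking bins are the bin of \<open>q\<close>. Hence
          \<open>fst j\<close> lies strictly between \<open>blocker j'\<close> and
          \<open>fst j'\<close>, and maximality of \<open>blocker j'\<close> makes bin
          \<open>fst j\<close> closed for good when \<open>item j'\<close> arrives.\<close>
        then have "blocker j' = blocker j" by (auto simp: C_def)
        then have "blocker j' < fst j" using blocker(1)[of j] * by auto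
        then show "X j \<inter> X j' = {}" using * J_eq by (intro after blocker_max) auto
      qed (use fin in auto)
      also have "\<dots> \<le> measure lborel ?I"
      proof (rule measure_mono_fmeasurable)
        show "(\<Union>j\<in>?K. X j) \<subseteq> ?I"
        proof safe
          fix j t assume "j \<in> J1" "q \<in> C j" "t \<in> X j"
          then have "t \<in> active_interval (item j)" "arrival (item j) \<in> active_interval (item q)" "duration (item j) \<le> M"
            using X_sub[of j] item_M[of j] J_eq(4) by (auto simp: C_def)
          then show "t \<in> ?I" by (auto simp: active_interval_def duration_def)
        qed
        show "(\<Union>j\<in>?K. X j) \<in> sets lborel"
          using fin by (intro sets.finite_UN) (simp_all add: X_sets)
        show "?I \<in> fmeasurable lborel" by (rule fmeasurable_compact) simp
      qed
      also have "\<dots> = duration (item q) + M"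
        using item_valid[OF that] item_M[OF that] by (auto simp: duration_def valid_item_def)
      finally show ?thesis .
    qed
    have "(\<Sum>j\<in>J1. measure lborel (X j)) \<le> (\<Sum>j\<in>J1. measure lborel (X j) * (\<sigma> j + (\<Sum>q\<in>C j. \<sigma> q)))"
    proof (rule sum_mono)
      fix j assume "j \<in> J1"
      then show "measure lborel (X j) \<le> measure lborel (X j) * (\<sigma> j + (\<Sum>q\<in>C j. \<sigma> q))"
        using mult_left_mono[OF less_imp_le[OF gt1[of j]] measure_nonneg[of lborel "X j"]] by simp
    qed
    also have "\<dots> = (\<Sum>j\<in>J1. measure lborel (X j) * \<sigma> j) + (\<Sum>j\<in>J1. \<Sum>q\<in>C j. measure lborel (X j) * \<sigma> q)"
      by (simp add: distrib_left sum.distrib sum_distrib_left)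
    \<comment> \<open>Writing \<open>C j\<close> as a filter of \<open>J\<close> prepares the
      exchange of summation, which collects for each \<open>q\<close> all the time passed on to
      it.\<close>
    also have "(\<Sum>j\<in>J1. \<Sum>q\<in>C j. measure lborel (X j) * \<sigma> q) =
        (\<Sum>j\<in>J1. \<Sum>q\<in>{q\<in>J. q \<in> C j}. measure lborel (X j) * \<sigma> q)"
      by (intro sum.cong refl) (auto simp: C_def)
    also have "\<dots> = (\<Sum>q\<in>J. \<Sum>j\<in>{j\<in>J1. q \<in> C j}. measure lborel (X j) * \<sigma> q)"
      by (rule sum.swap_restrict) (use fin in auto)
    also have "\<dots> \<le> (\<Sum>q\<in>J. (duration (item q) + M) * \<sigma> q)"
      unfolding sum_distrib_right[symmetric]
      by (intro sum_mono mult_right_mono charged \<sigma>_nonneg)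
    also have "(\<Sum>j\<in>J1. measure lborel (X j) * \<sigma> j) \<le> (\<Sum>j\<in>J. measure lborel (X j) * \<sigma> j)"
      by (intro sum_mono2 fin J_eq mult_nonneg_nonneg measure_nonneg \<sigma>_nonneg) blast
    also have "\<dots> \<le> (\<Sum>j\<in>J. duration (item j) * \<sigma> j)"
      by (intro sum_mono mult_right_mono X_le \<sigma>_nonneg)
    also have "\<dots> + (\<Sum>q\<in>J. (duration (item q) + M) * \<sigma> q) = (\<Sum>q\<in>J. (2 * duration (item q) + M) * \<sigma> q)"
      by (simp add: sum.distrib[symmetric] algebra_simps)
    also have "\<dots> = (\<Sum>q\<leftarrow>concat Bs. (2 * duration q + M) * total_size q)"
      unfolding J_def item_def \<sigma>_def
      by (subst sum_indices_eq_sum_list_concat[symmetric]) (simp add: case_prod_unfold)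
    finally show ?thesis by simp
  qed
  finally show ?thesis by simp
qed

section \<open>Lower bounds on the optimum\<close>

lemma sum_list_map_cong_mset:
  fixes f :: "'a \<Rightarrow> 'b::comm_monoid_add"
  assumes "mset xs = mset ys"
  shows "sum_list (map f xs) = sum_list (map f ys)"
  using assms by (simp only: mset_map sum_mset_sum_list[symmetric])

text \<open>One bin per item suffices, as no coordinate of a size exceeds 1. Hence the
  \<open>LEAST\<close> in \<open>OPT_at\<close> is attained.\<close>

lemma packable_length:
  assumes "\<forall>r\<in>set S. valid_item r"
  shows "packable S (length S)"
  unfolding packable_def using assms
  by (intro exI[of _ "map (\<lambda>r. [r]) S"]) (auto simp: within_capacity_def valid_item_def concat_map_singleton)

lemma packable_0_iff: "packable S 0 \<longleftrightarrow> S = []"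
  by (auto simp: packable_def)

lemma packable_imp_load_le:
  assumes "packable S k"
  shows "(\<Sum>r\<leftarrow>S. item_size r $ i) \<le> real k"
proof -
  obtain Bs where Bs: "length Bs = k" "mset (concat Bs) = mset S" "\<forall>B\<in>set Bs. within_capacity B"
    using assms by (auto simp: packable_def)
  have "(\<Sum>r\<leftarrow>S. item_size r $ i) = (\<Sum>r\<leftarrow>concat Bs. item_size r $ i)"
    using Bs(2) by (intro sum_list_map_cong_mset) simp
  also have "\<dots> = (\<Sum>B\<leftarrow>Bs. \<Sum>r\<leftarrow>B. item_size r $ i)"
    by (induction Bs) auto
  also have "\<dots> \<le> (\<Sum>B\<leftarrow>Bs. 1)"
    using Bs(3) by (intro sum_list_mono) (auto simp: within_capacity_def)
  also have "\<dots> = real k" using Bs(1) by (simp add: sum_list_triv)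
  finally show ?thesis .
qed

lemma packable_OPT_at:
  assumes "valid_instance R"
  shows "packable (active_items R t) (OPT_at R t)"
  unfolding OPT_at_def
  by (rule LeastI, rule packable_length) (use assms in \<open>auto simp: active_items_def valid_instance_iff\<close>)

lemma OPT_at_le_length:
  assumes "valid_instance R"
  shows "OPT_at R t \<le> length (active_items R t)"
  unfolding OPT_at_def
  by (rule Least_le, rule packable_length) (use assms in \<open>auto simp: active_items_def valid_instance_iff\<close>)

text \<open>Without integrability the integral in \<open>OPT\<close> would be 0 by convention. The
  dominating function is the number of active items, a finite sum of interval indicators.\<close>

lemma integrable_OPT_at:
  assumes "valid_instance R"
  shows "integrable lborel (\<lambda>t. real (OPT_at R t))"
proof (rule Bochner_Integration.integrable_bound)
  have "integrable lborel (\<lambda>t. indicator (active_interval r) t :: real)" for r :: "'a item"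
    using fmeasurableD[OF active_interval_fmeasurable[of r]] fmeasurableD2[OF active_interval_fmeasurable[of r]]
    by (auto simp: top.not_eq_extremum)
  then show "integrable lborel (\<lambda>t. \<Sum>r\<leftarrow>R. indicator (active_interval r) t :: real)"
    by (induction R) auto
  \<comment> \<open>\<open>F\<close> is arbitrary because the induction replaces it by
    \<open>F\<close> applied to \<open>r # _\<close> on the interval of \<open>r\<close>. This
    avoids any analysis of \<open>LEAST\<close>.\<close>
  have "(\<lambda>t. F (active_items R t)) \<in> borel_measurable lborel" for F :: "'a item list \<Rightarrow> real"
  proof (induction R arbitrary: F)
    case (Cons r R)
    have [measurable]: "active_interval r \<in> sets borel" by (simp add: active_interval_def)
    have [measurable]: "(\<lambda>t. F (r # active_items R t)) \<in> borel_measurable lborel"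
      "(\<lambda>t. F (active_items R t)) \<in> borel_measurable lborel" by (rule Cons.IH)+
    have "(\<lambda>t. F (active_items (r # R) t)) =
        (\<lambda>t. if t \<in> active_interval r then F (r # active_items R t) else F (active_items R t))"
      by (auto simp: active_items_def)
    then show ?case by simp
  qed (simp add: active_items_def)
  then show "(\<lambda>t. real (OPT_at R t)) \<in> borel_measurable lborel" unfolding OPT_at_def .
  have "real (length (active_items R t)) = (\<Sum>r\<leftarrow>R. indicator (active_interval r) t)" for t
    unfolding active_items_def by (induction R) auto
  then show "AE t in lborel. norm (real (OPT_at R t)) \<le> norm (\<Sum>r\<leftarrow>R. indicator (active_interval r) t :: real)"
    using OPT_at_le_length[OF assms] by (metis (mono_tags, lifting) AE_I2 abs_of_nat of_nat_le_iff real_norm_def)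
qed

text \<open>Whenever some item is active, at least one bin is needed.\<close>

lemma usage_span_le_OPT:
  assumes "valid_instance R"
  shows "usage_span (set R) \<le> OPT R"
proof -
  let ?U = "\<Union>r\<in>set R. active_interval r"
  have U: "?U \<in> fmeasurable lborel"
    using active_interval_fmeasurable by (intro fmeasurable.finite_UN) auto
  have "usage_span (set R) = (\<integral>t. indicator ?U t \<partial>lborel)"
    by (simp add: usage_span_def)
  also have "\<dots> \<le> OPT R"
    unfolding OPT_def
  proof (rule integral_mono)
    show "integrable lborel (\<lambda>t. indicator ?U t :: real)"
      using fmeasurableD[OF U] fmeasurableD2[OF U]  by (auto simp: top.not_eq_extremum)
    fix t
    show "indicator ?U t \<le> real (OPT_at R t)"
    proof (cases "t \<in> ?U")
      case True
      then have "active_items R t \<noteq> []" by (auto simp: active_items_def filter_empty_conv)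
      then have "OPT_at R t \<noteq> 0" using packable_OPT_at[OF assms, of t] by (metis packable_0_iff)
      then show ?thesis using True by simp
    qed simp
  qed (rule integrable_OPT_at[OF assms])
  finally show ?thesis .
qed

text \<open>The left side is the integral over time of the active 1-norms. At each time these sum up
  the loads of the \<open>d\<close> coordinates, each at most the number of bins.\<close>

lemma utilization_le_OPT:
  fixes R :: "'d::finite item list"
  assumes "valid_instance R"
  shows "(\<Sum>r\<leftarrow>R. duration r * total_size r) \<le> real CARD('d) * OPT R"
proof -
  let ?f = "\<lambda>t r. indicator (active_interval r) t * total_size r"
  have int: "integrable lborel (\<lambda>t. ?f t r)" for r :: "'d item"
    using fmeasurableD[OF active_interval_fmeasurable[of r]] fmeasurableD2[OF active_interval_fmeasurable[of r]]
    by (auto simp: top.not_eq_extremum)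
  have "(\<lambda>t. \<Sum>r\<leftarrow>R. ?f t r) = (\<lambda>t. \<Sum>k<length R. ?f t (R ! k))"
    by (simp add: sum_list_sum_nth atLeast0LessThan)
  then have int_sum: "integrable lborel (\<lambda>t. \<Sum>r\<leftarrow>R. ?f t r)"
    and eq: "(\<integral>t. (\<Sum>r\<leftarrow>R. ?f t r) \<partial>lborel) = (\<Sum>k<length R. \<integral>t. ?f t (R ! k) \<partial>lborel)"
    by (simp_all only: Bochner_Integration.integrable_sum Bochner_Integration.integral_sum int)
  have "(\<Sum>r\<leftarrow>R. duration r * total_size r) = (\<integral>t. (\<Sum>r\<leftarrow>R. ?f t r) \<partial>lborel)"
    unfolding eq using assms
    by (auto simp: sum_list_sum_nth atLeast0LessThan measure_active_interval valid_instance_iff intro!: sum.cong)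
  also have "\<dots> \<le> (\<integral>t. real CARD('d) * real (OPT_at R t) \<partial>lborel)"
  proof (rule integral_mono[OF int_sum])
    fix t
    have "(\<Sum>r\<leftarrow>R. ?f t r) = (\<Sum>r\<leftarrow>active_items R t. total_size r)"
      unfolding active_items_def by (induction R) auto
    also have "\<dots> = (\<Sum>i\<in>UNIV. \<Sum>r\<leftarrow>active_items R t. item_size r $ i)"
      unfolding total_size_def sum_list_sum_nth length_map by (subst sum.swap) simp
    also have "\<dots> \<le> (\<Sum>i\<in>(UNIV::'d set). real (OPT_at R t))"
      by (intro sum_mono packable_imp_load_le packable_OPT_at assms)
    finally show "(\<Sum>r\<leftarrow>R. ?f t r) \<le> real CARD('d) * real (OPT_at R t)" by simp
  qed (use integrable_OPT_at[OF assms] in simp)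
  finally show ?thesis by (simp add: OPT_def)
qed

section \<open>Combination of the bounds\<close>

theorem theorem2:
  fixes R :: "'d::finite item list"
  assumes "valid_instance R"
  shows "cost first_fit R \<le> ((duration_ratio R + 2) * real CARD('d) + 1) * OPT R"
proof (cases "R = []")
  \<comment> \<open>\<open>duration_ratio []\<close> is unspecified, but cost and optimum both
    vanish.\<close>
  case True
  have "OPT_at ([] :: 'd item list) t = 0" for t
    using OPT_at_le_length[OF assms, of t] True by (simp add: active_items_def)
  then show ?thesis using True by (simp add: cost_def first_fit_def OPT_def)
next
  case False
  define M where "M = Max (duration ` set R)"
  define m where "m = Min (duration ` set R)"
  have le: "duration r \<le> M" "m \<le> duration r" if "r \<in> set R" for r
    using that by (auto simp: M_def m_def)
  have "m \<in> duration ` set R" unfolding m_def using False by (intro Min_in) auto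
  then have "0 < m" using assms by (auto simp: valid_instance_iff valid_item_def duration_def)
  have "m \<le> M" using le False by (metis hd_in_set order_trans)
  have ratio: "duration_ratio R = M / m" by (simp add: duration_ratio_def M_def m_def)
  \<comment> \<open>With \<mu> = \<open>M / m\<close>, the maximal duration is \<mu> times the
    minimal one. This turns the weight \<open>2 * duration q + M\<close> into at most \<mu> + 2
    durations of \<open>q\<close>.\<close>
  have M_le: "M \<le> duration_ratio R * duration r" if "r \<in> set R" for r
    using le[OF that] \<open>0 < m\<close> \<open>m \<le> M\<close> by (simp add: ratio pos_le_divide_eq mult_left_mono)
  have set_eq: "set (concat (first_fit R)) = set R"
    using mset_concat_first_fit by (rule mset_eq_setD)
  have "cost first_fit R \<le> usage_span (set R) +
      (\<Sum>q\<leftarrow>concat (first_fit R). (2 * duration q + M) * total_size q)"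
    using sum_usage_span_le[OF sorted_wrt_rejects_first_fit[OF assms], of M] assms le
    unfolding cost_def set_eq valid_instance_iff by blast
  also have "(\<Sum>q\<leftarrow>concat (first_fit R). (2 * duration q + M) * total_size q) =
      (\<Sum>q\<leftarrow>R. (2 * duration q + M) * total_size q)"
    by (rule sum_list_map_cong_mset[OF mset_concat_first_fit])
  also have "\<dots> \<le> (\<Sum>q\<leftarrow>R. (duration_ratio R + 2) * (duration q * total_size q))"
  proof (rule sum_list_mono)
    fix q assume q: "q \<in> set R"
    then have "(2 * duration q + M) * total_size q \<le> (2 * duration q + duration_ratio R * duration q) * total_size q"
      using M_le assms by (intro mult_right_mono total_size_nonneg) (auto simp: valid_instance_iff)
    then show "(2 * duration q + M) * total_size q \<le> (duration_ratio R + 2) * (duration q * total_size q)"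
      by (simp add: algebra_simps)
  qed
  also have "\<dots> = (duration_ratio R + 2) * (\<Sum>q\<leftarrow>R. duration q * total_size q)"
    by (simp add: sum_list_const_mult)
  also have "\<dots> \<le> (duration_ratio R + 2) * (real CARD('d) * OPT R)"
    using utilization_le_OPT[OF assms] \<open>0 < m\<close> \<open>m \<le> M\<close> by (intro mult_left_mono) (auto simp: ratio)
  finally show ?thesis using usage_span_le_OPT[OF assms] by (simp add: algebra_simps)
qed

end
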